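(* Assume that $0\le \tau_{ij}(t)\le\tau$ for all $t\ge 0$ and all $i,j=1,\dots,N$, and that the digraph $\mathcal G$ is strongly connected, with depth $\gamma$. Let $\psi:\mathbb R^d\times\mathbb R^d\to\mathbb R$ be a positive, bounded, continuous function. Assume that the weight functions $\alpha_{ij}:[0,+\infty)\to[0,1]$ are Lebesgue measurable and satisfy the Persistence Excitation Condition: there exist constants $T>0$ and $\tilde\alpha>0$ such that $$\int_t^{t+T}\alpha_{ij}(s)\,ds\ge\tilde\alpha\qquad\text{for all } t\ge 0 \text{ and all } i,j \text{ with } \chi_{ij}=1 .$$ Let $x_i^0:[-\tau,0]\to\mathbb R^d$ be a continuous function for each $i=1,\dots,N$. Then there is a constant $C>0$ such that every solution $\{x_i\}_{i=1,\dots,N}$ of the system $$\frac{d}{dt}x_i(t)=\sum_{j:\,j\ne i}\chi_{ij}\,\alpha_{ij}(t)\,b_{ij}(t)\,\bigl(x_j(t-\tau_{ij}(t))-x_i(t)\bigr),\quad t>0,\ i=1,\dots,N,$$ with $b_{ij}(t)=\frac{1}{N-1}\psi(x_i(t),x_j(t-\tau_{ij}(t)))$ and initial conditions $x_i(s)=x_i^0(s)$ for $s\in[-\tau,0]$, $i=1,\dots,N$, satisfies $$d(t)\le\Bigl(\max_{i,j=1,\dots,N}\ \max_{r,s\in[-\tau,0]}|x_i(r)-x_j(s)|\Bigr)\,e^{-C(t-\gamma(T+\tau)-\tau)}\qquad\text{for all } t\ge 0,$$ where $d(t):=\max_{i,j=1,\dots,N}|x_i(t)-x_j(t)|$.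
   Context: $N\ge 2$ and $d\ge1$ are integers, $|\cdot|$ is the Euclidean norm on $\mathbb R^d$, and $\tau>0$ is a constant. The delay functions $\tau_{ij}:[0,+\infty)\to[0,+\infty)$ are continuous. Graph: $\mathcal G=(\mathcal V,\mathcal E)$ is a digraph with vertex set $\mathcal V=\{1,\dots,N\}$ and no self-loops; $\chi_{ij}=1$ if $(i,j)\in\mathcal E$ (agent $j$ transmits information to agent $i$) and $\chi_{ij}=0$ otherwise. A path from $i_0$ to $i_p$ is a finite sequence $i_0,\dots,i_p$ of distinct vertices such that each successive pair is an arc of $\mathcal G$; $p$ is its length. $\mathrm{dist}(i,j)$ is the length of the shortest path from $i$ to $j$. $\mathcal G$ is strongly connected if each vertex is reachable by a path from any other vertex. The depth of $\mathcal G$ is $\gamma:=\max_{i,j=1,\dots,N}\mathrm{dist}(i,j)$. A solution is a family of continuous functions $x_i:[-\tau,+\infty)\to\mathbb R^d$, locally absolutely continuous on $[0,+\infty)$, satisfying the system for almost every $t>0$ and the initial conditions on $[-\tau,0]$. "Positive" means strictly positive. *)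

theory Defs
  imports
    "HOL-Analysis.Analysis"
    "Graph_Theory.Digraph_Component_Vwalk"
begin

text \<open>
  Absolute continuity of a function of one real variable (the library constant
  \<open>absolutely_continuous\<close> is about measures). The intervals of a finite family may
  share end points.
\<close>

definition abs_continuous_on :: "real set \<Rightarrow> (real \<Rightarrow> 'a::real_normed_vector) \<Rightarrow> bool" where
  "abs_continuous_on S f \<longleftrightarrow>
     (\<forall>\<epsilon>>0. \<exists>\<delta>>0. \<forall>(n::nat) (a::nat \<Rightarrow> real) (b::nat \<Rightarrow> real).
        (\<forall>k<n. a k \<le> b k \<and> {a k..b k} \<subseteq> S) \<longrightarrow>
        (\<forall>k<n. \<forall>l<n. k \<noteq> l \<longrightarrow> {a k<..<b k} \<inter> {a l<..<b l} = {}) \<longrightarrow>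
        (\<Sum>k<n. b k - a k) < \<delta> \<longrightarrow>
        (\<Sum>k<n. norm (f (b k) - f (a k))) < \<epsilon>)"

definition locally_abs_continuous_on :: "real set \<Rightarrow> (real \<Rightarrow> 'a::real_normed_vector) \<Rightarrow> bool" where
  "locally_abs_continuous_on S f \<longleftrightarrow> (\<forall>a b. {a..b} \<subseteq> S \<longrightarrow> abs_continuous_on {a..b} f)"

text \<open>
  An arc \<open>(i, j)\<close> means that agent \<open>j\<close> transmits information to agent \<open>i\<close>.
\<close>

definition arc_indicator :: "'v pair_pre_digraph \<Rightarrow> 'v \<Rightarrow> 'v \<Rightarrow> real" where
  "arc_indicator G i j = of_bool ((i, j) \<in> parcs G)"

text \<open>
  A \<open>vpath\<close> is a nonempty list of distinct vertices whose successive pairs are arcs, so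
  \<open>[i]\<close> is a path of length 0 from \<open>i\<close> to \<open>i\<close>. The value is meaningful only if a path from
  \<open>i\<close> to \<open>j\<close> exists, as is always the case in a strongly connected digraph.
\<close>

definition digraph_dist :: "'v pair_pre_digraph \<Rightarrow> 'v \<Rightarrow> 'v \<Rightarrow> nat" where
  "digraph_dist G i j =
     (LEAST n. \<exists>p. vpath p (with_proj G) \<and> hd p = i \<and> last p = j \<and> vwalk_length p = n)"

definition digraph_depth :: "'v pair_pre_digraph \<Rightarrow> nat" where
  "digraph_depth G = (MAX (i, j) \<in> pverts G \<times> pverts G. digraph_dist G i j)"

definition interaction ::
    "nat \<Rightarrow> ((real^'d) \<times> (real^'d) \<Rightarrow> real) \<Rightarrow> (nat \<Rightarrow> nat \<Rightarrow> real \<Rightarrow> real) \<Rightarrow>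
     (nat \<Rightarrow> real \<Rightarrow> real^'d) \<Rightarrow> nat \<Rightarrow> nat \<Rightarrow> real \<Rightarrow> real" where
  "interaction N \<psi> delay x i j t = 1 / (real N - 1) * \<psi> (x i t, x j (t - delay i j t))"

text \<open>
  Only the values of \<open>x i\<close> on \<open>{-\<tau>..}\<close> for \<open>i \<in> {1..N}\<close> matter.
\<close>

definition is_solution ::
    "nat \<Rightarrow> nat pair_pre_digraph \<Rightarrow> ((real^'d) \<times> (real^'d) \<Rightarrow> real) \<Rightarrow>
     (nat \<Rightarrow> nat \<Rightarrow> real \<Rightarrow> real) \<Rightarrow> (nat \<Rightarrow> nat \<Rightarrow> real \<Rightarrow> real) \<Rightarrow> real \<Rightarrow>
     (nat \<Rightarrow> real \<Rightarrow> real^'d) \<Rightarrow> (nat \<Rightarrow> real \<Rightarrow> real^'d) \<Rightarrow> bool" where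
  "is_solution N G \<psi> \<alpha> delay \<tau> x0 x \<longleftrightarrow>
     (\<forall>i\<in>{1..N}. continuous_on {-\<tau>..} (x i) \<and> locally_abs_continuous_on {0..} (x i)) \<and>
     (AE t in lebesgue. t > 0 \<longrightarrow> (\<forall>i\<in>{1..N}.
        (x i has_vector_derivative
          (\<Sum>j\<in>{1..N} - {i}. (arc_indicator G i j * \<alpha> i j t * interaction N \<psi> delay x i j t) *\<^sub>R
             (x j (t - delay i j t) - x i t))) (at t))) \<and>
     (\<forall>i\<in>{1..N}. \<forall>s\<in>{-\<tau>..0}. x i s = x0 i s)"

definition diam_at :: "nat \<Rightarrow> (nat \<Rightarrow> real \<Rightarrow> real^'d) \<Rightarrow> real \<Rightarrow> real" where
  "diam_at N x t = (MAX (i, j) \<in> {1..N} \<times> {1..N}. norm (x i t - x j t))"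

text \<open>
  For functions continuous on \<open>{-\<tau>..0}\<close> the supremum is attained, i.e. it is a maximum.
\<close>

definition history_diam :: "nat \<Rightarrow> real \<Rightarrow> (nat \<Rightarrow> real \<Rightarrow> real^'d) \<Rightarrow> real" where
  "history_diam N \<tau> x =
     (MAX (i, j) \<in> {1..N} \<times> {1..N}. SUP (r, s) \<in> {-\<tau>..0} \<times> {-\<tau>..0}. norm (x i r - x j s))"

end

theory Submission
  imports Defs
begin

text \<open>
  For a vector \<open>v\<close> the scalars \<open>z i t = v \<bullet> x i t\<close> form a linear consensus system with weights
  \<open>w i j t \<ge> 0\<close> whose row sums are at most \<open>K = sup \<psi>\<close>; an affine change of variables preserves it.
  If \<open>z \<ge> 0\<close> on a history interval of length \<open>\<tau>\<close>, then \<open>z \<ge> 0\<close> from then on, so solutions stay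
  bounded and \<open>\<psi>\<close> is bounded below along them. Moreover \<open>z\<close> decays at most at rate \<open>K\<close>, and if
  \<open>z j \<ge> A\<close> and \<open>(i, j)\<close> is an arc, persistence of excitation gives \<open>z i \<ge> q * A\<close> once a further
  time \<open>T + \<tau>\<close> has passed, for a constant \<open>q > 0\<close>. Following shortest paths to a fixed vertex, the
  distance of that vertex from one end of the range of the history reaches all vertices after time
  \<open>\<gamma> * (T + \<tau>)\<close>, so the diameter of the history contracts by a fixed factor over each period of
  length \<open>\<gamma> * (T + \<tau>) + \<tau>\<close>. Taking for \<open>v\<close> the direction of the difference to be estimated
  reduces the vector case to the scalar one.
\<close>

section \<open>Absolutely continuous functions\<close>

text \<open>Bundles the three side conditions on a finite family of intervals, so that each
  epsilon-delta argument carries a single hypothesis.\<close>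

definition short_nonoverlapping :: "real set \<Rightarrow> real \<Rightarrow> nat \<Rightarrow> (nat \<Rightarrow> real) \<Rightarrow> (nat \<Rightarrow> real) \<Rightarrow> bool" where
  "short_nonoverlapping S d n u v \<longleftrightarrow>
     (\<forall>k<n. u k \<le> v k \<and> {u k..v k} \<subseteq> S) \<and>
     (\<forall>k<n. \<forall>l<n. k \<noteq> l \<longrightarrow> {u k<..<v k} \<inter> {u l<..<v l} = {}) \<and>
     (\<Sum>k<n. v k - u k) < d"

lemma abs_continuous_on_iff:
  "abs_continuous_on S f \<longleftrightarrow>
     (\<forall>e>0. \<exists>d>0. \<forall>n u v. short_nonoverlapping S d n u v \<longrightarrow>
        (\<Sum>k<n. norm (f (v k) - f (u k))) < e)"
  unfolding abs_continuous_on_def short_nonoverlapping_def imp_conjL by (rule refl)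

text \<open>Distinct tagged intervals have disjoint interiors, so an enumeration of \<open>p\<close>
  turns them into a family admissible for absolute continuity. This is the form in which a gauge
  integral can use it.\<close>

lemma abs_continuous_on_tagged_partial_division:
  fixes f :: "real \<Rightarrow> 'a::real_normed_vector"
  assumes "abs_continuous_on {a..b} f" and "e > 0"
  obtains d where "d > 0"
    and "\<And>p. p tagged_partial_division_of {a..b} \<Longrightarrow> (\<Sum>(x,K)\<in>p. measure lborel K) < d \<Longrightarrow>
           (\<Sum>(x,K)\<in>p. norm (f (Sup K) - f (Inf K))) < e"
proof -
  obtain d where d: "d > 0" and
    ac: "\<And>n u v. short_nonoverlapping {a..b} d n u v \<Longrightarrow> (\<Sum>k<n. norm (f (v k) - f (u k))) < e"
    using assms unfolding abs_continuous_on_iff by blast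
  show thesis
  proof (rule that[OF d])
    fix p assume p: "p tagged_partial_division_of {a..b}" and small: "(\<Sum>(x,K)\<in>p. measure lborel K) < d"
    have "finite p" using p by (rule tagged_partial_division_ofD(1))
    then obtain h where h: "bij_betw h {..<card p} p"
      using ex_bij_betw_nat_finite lessThan_atLeast0 by metis
    define u where "u k = Inf (snd (h k))" for k
    define v where "v k = Sup (snd (h k))" for k
    have K: "snd (h k) = {u k..v k} \<and> u k \<le> v k \<and> {u k..v k} \<subseteq> {a..b}" if "k < card p" for k
    proof -
      have "h k \<in> p" using h that by (auto simp: bij_betw_def)
      then obtain x K where xK: "h k = (x, K)" "(x, K) \<in> p" by (cases "h k") auto
      obtain s t where "K = cbox s t" "x \<in> K" "K \<subseteq> {a..b}"
        using tagged_partial_division_ofD[OF p] xK(2) by metis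
      then show ?thesis using xK(1) by (auto simp: u_def v_def)
    qed
    have disj: "{u k<..<v k} \<inter> {u l<..<v l} = {}" if "k < card p" "l < card p" "k \<noteq> l" for k l
    proof -
      have "h k \<in> p" "h l \<in> p" using h that by (auto simp: bij_betw_def)
      moreover have "h k \<noteq> h l" using h that by (auto simp: bij_betw_def inj_on_def)
      ultimately have "interior (snd (h k)) \<inter> interior (snd (h l)) = {}"
        using tagged_partial_division_ofD(5)[OF p, of "fst (h k)" "snd (h k)" "fst (h l)" "snd (h l)"]
        by simp
      then show ?thesis using K that by simp
    qed
    have sum_p: "(\<Sum>k<card p. g (snd (h k))) = (\<Sum>(x,K)\<in>p. g K)" for g :: "real set \<Rightarrow> real"
      using sum.reindex_bij_betw[OF h, of "\<lambda>q. g (snd q)"] by (simp add: case_prod_beta)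
    have "(\<Sum>k<card p. v k - u k) = (\<Sum>k<card p. measure lborel (snd (h k)))"
      by (intro sum.cong refl) (use K in simp)
    then have len: "(\<Sum>k<card p. v k - u k) < d" using small sum_p by simp
    have "(\<Sum>k<card p. norm (f (v k) - f (u k))) < e"
      by (rule ac) (use K disj len in \<open>auto simp: short_nonoverlapping_def\<close>)
    then show "(\<Sum>(x,K)\<in>p. norm (f (Sup K) - f (Inf K))) < e"
      using sum_p[of "\<lambda>K. norm (f (Sup K) - f (Inf K))"] by (simp add: u_def v_def)
  qed
qed

text \<open>The gauge has to be small in two different ways: at points of differentiability it controls the
  difference quotient, and on the exceptional set it keeps the total length of the intervals tagged
  there below the threshold of absolute continuity.\<close>

lemma fundamental_theorem_of_calculus_abs_continuous:
  fixes f :: "real \<Rightarrow> 'a::banach"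
  assumes "a \<le> b" and ac: "abs_continuous_on {a..b} f" and E: "negligible E"
    and vecd: "\<And>x. x \<in> {a..b} - E \<Longrightarrow> (f has_vector_derivative f' x) (at x within {a..b})"
  shows "(f' has_integral (f b - f a)) {a..b}"
proof -
  \<comment> \<open>\<open>f'\<close> is arbitrary on \<open>E\<close>. With the value 0 there,
    pieces tagged in \<open>E\<close> contribute nothing to the Riemann sum, and only the increments
    of \<open>f\<close> over them remain to be estimated.\<close>
  define g where "g x = (if x \<in> E then 0 else f' x)" for x
  have "(g has_integral (f b - f a)) (cbox a b)"
    unfolding has_integral
  proof (intro allI impI)
    fix e :: real assume "e > 0"
    \<comment> \<open>The summand 1 keeps the denominator positive when \<open>a = b\<close>; in
      every case \<open>e1 * (b - a) \<le> e / 2\<close>.\<close>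
    define e1 where "e1 = e / 2 / (b - a + 1)"
    have "e1 > 0" using \<open>e > 0\<close> \<open>a \<le> b\<close> by (simp add: e1_def)
    obtain \<delta> where "\<delta> > 0" and \<delta>: "\<And>p. p tagged_partial_division_of {a..b} \<Longrightarrow>
        (\<Sum>(x,K)\<in>p. measure lborel K) < \<delta> \<Longrightarrow> (\<Sum>(x,K)\<in>p. norm (f (Sup K) - f (Inf K))) < e/2"
      using abs_continuous_on_tagged_partial_division[OF ac, of "e/2"] \<open>e > 0\<close> by auto
    have "E \<in> null_sets lebesgue" using E negligible_iff_null_sets by blast
    \<comment> \<open>Outer regularity encloses the null set in an open set whose measure is below
      the threshold of absolute continuity.\<close>
    then obtain U where U: "open U" "E \<subseteq> U" "U - E \<in> lmeasurable" "emeasure lebesgue (U - E) < ennreal \<delta>"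
      using sets_lebesgue_outer_open[of E \<delta>] \<open>\<delta> > 0\<close> by blast
    have "emeasure lebesgue U = emeasure lebesgue (U - E)"
      by (metis E emeasure_Diff_null_set negligible_iff_null_sets U(1) borel_open sets_completionI_sets sets_lborel)
    then have emU: "emeasure lebesgue U < ennreal \<delta>" using U(4) by simp
    then have Um: "U \<in> lmeasurable"
      using U(1) by (intro fmeasurableI) (auto simp: top.not_eq_extremum[symmetric] order_less_le_trans)
    then have measU: "measure lebesgue U < \<delta>"
      using emU emeasure_eq_measure2[OF Um] by (simp add: ennreal_less_iff)
    have "\<exists>d>0. (x \<in> {a..b} - E \<longrightarrow>
          (\<forall>y\<in>{a..b}. norm (y-x) < d \<longrightarrow> norm (f y - f x - (y-x) *\<^sub>R f' x) \<le> e1 * norm (y-x)))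
        \<and> (x \<in> E \<longrightarrow> ball x d \<subseteq> U)" for x
    proof (cases "x \<in> E")
      case True
      then show ?thesis using U(1,2) by (metis Diff_iff open_contains_ball subsetD)
    next
      case False
      then show ?thesis
        using vecd[of x] \<open>e1 > 0\<close>
        unfolding has_vector_derivative_def has_derivative_within_alt
        by (metis Diff_iff zero_less_one)
    qed
    then obtain d where d: "\<And>x. 0 < d x"
        "\<And>x y. \<lbrakk>x \<in> {a..b} - E; y \<in> {a..b}; norm (y-x) < d x\<rbrakk>
               \<Longrightarrow> norm (f y - f x - (y-x) *\<^sub>R f' x) \<le> e1 * norm (y-x)"
        "\<And>x. x \<in> E \<Longrightarrow> ball x (d x) \<subseteq> U"
      by metis
    show "\<exists>\<gamma>. gauge \<gamma> \<and> (\<forall>p. p tagged_division_of (cbox a b) \<and> \<gamma> fine p \<longrightarrow>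
            norm ((\<Sum>(x,K)\<in>p. measure lborel K *\<^sub>R g x) - (f b - f a)) < e)"
    proof (intro exI[of _ "\<lambda>x. ball x (d x)"] conjI allI impI; (elim conjE)?)
      show "gauge (\<lambda>x. ball x (d x))"
        using d(1) gauge_ball_dependent by blast
    next
      fix p assume ptag: "p tagged_division_of cbox a b" and fine: "(\<lambda>x. ball x (d x)) fine p"
      have fin: "finite p" using ptag by blast
      have ba: "b - a = (\<Sum>(x,K)\<in>p. Sup K - Inf K)" "f b - f a = (\<Sum>(x,K)\<in>p. f(Sup K) - f(Inf K))"
        using additive_tagged_division_1[where f= "\<lambda>x. x"] additive_tagged_division_1[where f= f]
              \<open>a \<le> b\<close> ptag by auto
      define q where "q = {z \<in> p. fst z \<in> E}"
      have qp: "q \<subseteq> p" by (auto simp: q_def)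
      have qpart: "q tagged_partial_division_of {a..b}"
        using ptag qp by (metis cbox_interval tagged_division_of_def tagged_partial_division_subset)
      have interval: "\<exists>u v. K = {u..v} \<and> u \<le> x \<and> x \<le> v \<and> a \<le> u \<and> v \<le> b \<and> K \<subseteq> ball x (d x)"
        if "(x, K) \<in> p" for x K
      proof -
        have "x \<in> K" "K \<subseteq> {a..b}" "\<exists>u v. K = cbox u v"
          using tagged_division_ofD[OF ptag] that by auto
        moreover have "K \<subseteq> ball x (d x)" using fine that by (auto simp: fine_def)
        ultimately show ?thesis by fastforce
      qed
      \<comment> \<open>The pieces do not overlap, so their total length is the measure of their
        union, which the gauge confines to \<open>U\<close>.\<close>
      have "(\<Sum>(x,K)\<in>q. measure lborel K) = measure lebesgue (\<Union>(snd ` q))"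
      proof -
        have "q tagged_division_of \<Union>(snd ` q)"
          using qpart by (auto simp: tagged_division_of_def tagged_partial_division_of_def)
        then have "snd ` q division_of \<Union>(snd ` q)" and *: "q tagged_division_of \<Union>(snd ` q)"
          using division_of_tagged_division by auto
        have "(\<Sum>(x,K)\<in>q. measure lebesgue K) = (\<Sum>K\<in>snd ` q. measure lebesgue K)"
          by (rule sum.over_tagged_division_lemma[OF *])
             (metis box_real(1) content_eq_0_interior interior_cbox measure_completion cbox_borel sets_lborel)
        also have "\<dots> = measure lebesgue (\<Union>(snd ` q))"
          by (rule content_division[OF \<open>snd ` q division_of _\<close>])
        also have "(\<Sum>(x,K)\<in>q. measure lebesgue K) = (\<Sum>(x,K)\<in>q. measure lborel K)"
          using interval qp by (intro sum.cong refl) fastforce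
        finally show ?thesis .
      qed
      also have "\<dots> \<le> measure lebesgue U"
      proof -
        have "\<Union>(snd ` q) \<subseteq> U"
          using interval d(3) unfolding q_def by fastforce
        moreover have "finite q" using fin qp finite_subset by blast
        moreover have "\<Union>(snd ` q) \<in> sets borel"
        proof (rule sets.finite_Union)
          show "snd ` q \<subseteq> sets borel"
          proof
            fix K assume "K \<in> snd ` q"
            then obtain x where "(x, K) \<in> p" using qp by auto
            then obtain u v where "K = {u..v}" using interval by blast
            then show "K \<in> sets borel" by simp
          qed
        qed (use \<open>finite q\<close> in auto)
        ultimately show ?thesis
          using Um by (metis measure_mono_fmeasurable sets_completionI_sets sets_lborel)
      qed
      finally have "(\<Sum>(x,K)\<in>q. norm (f (Sup K) - f (Inf K))) < e/2"
        using \<delta>[OF qpart] measU by simp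
      moreover have "norm (\<Sum>(x,K)\<in>p. (measure lborel K *\<^sub>R g x) - (f (Sup K) - f (Inf K))) \<le>
        (\<Sum>(x,K)\<in>p. e1 * (Sup K - Inf K) + (if x \<in> E then norm (f (Sup K) - f (Inf K)) else 0))"
      proof (rule sum_norm_le, safe)
        fix x K assume xK: "(x,K) \<in> p"
        obtain u v where K: "K = {u..v}" "u \<le> x" "x \<le> v" "a \<le> u" "v \<le> b" "K \<subseteq> ball x (d x)"
          using interval[OF xK] by blast
        then have uv: "u \<le> v" by simp
        show "norm (measure lborel K *\<^sub>R g x - (f (Sup K) - f (Inf K))) \<le>
          e1 * (Sup K - Inf K) + (if x \<in> E then norm (f (Sup K) - f (Inf K)) else 0)"
        proof (cases "x \<in> E")
          case True
          then show ?thesis using uv \<open>e1 > 0\<close> by (simp add: K(1) g_def norm_minus_commute)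
        next
          case False
          have "u \<in> K" "v \<in> K" using K(1) uv by auto
          then have "u \<in> ball x (d x)" "v \<in> ball x (d x)" using K(6) by blast+
          then have b: "norm (f u - f x - (u-x) *\<^sub>R f' x) \<le> e1 * norm (u-x)"
                  "norm (f v - f x - (v-x) *\<^sub>R f' x) \<le> e1 * norm (v-x)"
            using d(2)[of x u] d(2)[of x v] K False by (auto simp: dist_norm norm_minus_commute)
          \<comment> \<open>The increment is split at the tag \<open>x\<close>. Since
            \<open>u \<le> x \<le> v\<close>, the two errors add up to \<open>e1 * (v - u)\<close>
            exactly.\<close>
          have "norm ((v - u) *\<^sub>R f' x - (f v - f u)) = norm (f u - f x - (u - x) *\<^sub>R f' x - (f v - f x - (v - x) *\<^sub>R f' x))"
            by (auto simp: algebra_simps)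
          also have "\<dots> \<le> e1 * norm (u-x) + e1 * norm (v-x)"
            by (rule order_trans[OF norm_triangle_ineq4 add_mono[OF b(1) b(2)]])
          also have "\<dots> = e1 * (v - u)"
            using K by (simp add: algebra_simps)
          finally show ?thesis using uv False by (simp add: K(1) g_def)
        qed
      qed
      moreover have "(\<Sum>(x,K)\<in>p. e1 * (Sup K - Inf K) + (if x \<in> E then norm (f (Sup K) - f (Inf K)) else 0))
          = e1 * (b - a) + (\<Sum>(x,K)\<in>q. norm (f (Sup K) - f (Inf K)))"
      proof -
        have "(\<Sum>(x,K)\<in>q. norm (f (Sup K) - f (Inf K))) =
            (\<Sum>(x,K)\<in>p. if x \<in> E then norm (f (Sup K) - f (Inf K)) else 0)"
          unfolding q_def using fin by (simp add: sum.inter_filter case_prod_beta)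
        then show ?thesis
          by (simp add: ba(1) sum.distrib case_prod_beta sum_distrib_left)
      qed
      moreover have "e1 * (b - a) \<le> e / 2"
        using \<open>e > 0\<close> \<open>a \<le> b\<close> by (simp add: e1_def field_simps)
      ultimately show "norm ((\<Sum>(x,K)\<in>p. measure lborel K *\<^sub>R g x) - (f b - f a)) < e"
        by (simp add: ba(2) sum_subtractf case_prod_beta)
    qed
  qed
  then show ?thesis
    by (intro has_integral_spike[OF E, of _ f' g]) (auto simp: g_def)
qed

lemma abs_continuous_on_bounded_linear:
  assumes "bounded_linear h" and "abs_continuous_on S f"
  shows "abs_continuous_on S (\<lambda>x. h (f x))"
  unfolding abs_continuous_on_iff
proof (intro allI impI)
  fix e :: real assume "e > 0"
  obtain K where K: "K > 0" "\<And>x. norm (h x) \<le> norm x * K"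
    using bounded_linear.pos_bounded[OF assms(1)] by blast
  obtain d where d: "d > 0" "\<And>n u v.
        short_nonoverlapping S d n u v \<Longrightarrow>
        (\<Sum>k<n. norm (f (v k) - f (u k))) < e / K"
    using assms(2) \<open>e > 0\<close> K(1) unfolding abs_continuous_on_iff by (metis divide_pos_pos)
  show "\<exists>d>0. \<forall>n u v.
        short_nonoverlapping S d n u v \<longrightarrow>
        (\<Sum>k<n. norm (h (f (v k)) - h (f (u k)))) < e"
  proof (intro exI[of _ d] conjI allI impI d(1))
    fix n :: nat and u v :: "nat \<Rightarrow> real"
    assume *: "short_nonoverlapping S d n u v"
    have "(\<Sum>k<n. norm (h (f (v k)) - h (f (u k)))) \<le> (\<Sum>k<n. norm (f (v k) - f (u k)) * K)"
      using K(2) by (intro sum_mono) (metis assms(1) linear_diff bounded_linear.linear)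
    also have "\<dots> = K * (\<Sum>k<n. norm (f (v k) - f (u k)))"
      by (simp add: sum_distrib_left mult.commute)
    also have "\<dots> < e"
      using d(2)[OF *] K(1) by (simp add: field_simps)
    finally show "(\<Sum>k<n. norm (h (f (v k)) - h (f (u k)))) < e" .
  qed
qed

text \<open>An increment of the product splits into \<open>g\<close> times an increment of
  \<open>f\<close> plus \<open>f\<close> times an increment of \<open>g\<close>; the second is
  controlled by the length of the interval. It serves for multiplication by an exponential
  integrating factor.\<close>

lemma abs_continuous_on_lipschitz_mult:
  fixes f g :: "real \<Rightarrow> real"
  assumes f: "abs_continuous_on S f" and g: "C-lipschitz_on S g"
    and bf: "\<And>x. x \<in> S \<Longrightarrow> \<bar>f x\<bar> \<le> A" and bg: "\<And>x. x \<in> S \<Longrightarrow> \<bar>g x\<bar> \<le> B"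
  shows "abs_continuous_on S (\<lambda>x. g x * f x)"
  unfolding abs_continuous_on_iff
proof (intro allI impI)
  fix e :: real assume "e > 0"
  \<comment> \<open>The added 1 in \<open>A'\<close> and \<open>B'\<close> permits division; the
    absolute values cover an empty \<open>S\<close>, where \<open>A\<close> and \<open>B\<close> may
    be negative.\<close>
  define A' where "A' = \<bar>A\<bar> * C + 1"
  define B' where "B' = \<bar>B\<bar> + 1"
  have C: "C \<ge> 0" using g by (rule lipschitz_on_nonneg)
  have pos: "A' > 0" "B' > 0" using C by (auto simp: A'_def B'_def add_nonneg_pos)
  obtain d where d: "d > 0" "\<And>n u v.
        short_nonoverlapping S d n u v \<Longrightarrow>
        (\<Sum>k<n. norm (f (v k) - f (u k))) < e / 2 / B'"
    using f \<open>e > 0\<close> pos(2) unfolding abs_continuous_on_iff by (metis divide_pos_pos half_gt_zero)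
  show "\<exists>d>0. \<forall>n u v.
        short_nonoverlapping S d n u v \<longrightarrow>
        (\<Sum>k<n. norm (g (v k) * f (v k) - g (u k) * f (u k))) < e"
  proof (intro exI[of _ "min d (e / 2 / A')"] conjI allI impI)
    show "min d (e / 2 / A') > 0" using d(1) \<open>e > 0\<close> pos by simp
    fix n :: nat and u v :: "nat \<Rightarrow> real"
    assume *: "short_nonoverlapping S (min d (e / 2 / A')) n u v"
    then have *: "\<And>k. k < n \<Longrightarrow> u k \<le> v k \<and> {u k..v k} \<subseteq> S"
        "short_nonoverlapping S d n u v" "(\<Sum>k<n. v k - u k) < e / 2 / A'"
      by (auto simp: short_nonoverlapping_def)
    have "(\<Sum>k<n. norm (g (v k) * f (v k) - g (u k) * f (u k))) \<le>
        (\<Sum>k<n. B' * norm (f (v k) - f (u k)) + A' * (v k - u k))"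
    proof (rule sum_mono)
      fix k assume "k \<in> {..<n}"
      then have uv: "u k \<le> v k" "u k \<in> S" "v k \<in> S" using *(1)[of k] by auto
      have "norm (g (v k) * f (v k) - g (u k) * f (u k)) =
          \<bar>g (v k) * (f (v k) - f (u k)) + f (u k) * (g (v k) - g (u k))\<bar>"
        by (simp add: algebra_simps)
      also have "\<dots> \<le> \<bar>g (v k)\<bar> * \<bar>f (v k) - f (u k)\<bar> + \<bar>f (u k)\<bar> * \<bar>g (v k) - g (u k)\<bar>"
        by (metis abs_mult abs_triangle_ineq)
      also have "\<dots> \<le> B' * norm (f (v k) - f (u k)) + A' * (v k - u k)"
      proof (rule add_mono)
        show "\<bar>g (v k)\<bar> * \<bar>f (v k) - f (u k)\<bar> \<le> B' * norm (f (v k) - f (u k))"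
          using bg[OF uv(3)] by (auto simp: B'_def intro!: mult_right_mono)
        have "\<bar>g (v k) - g (u k)\<bar> \<le> C * (v k - u k)"
          using lipschitz_onD[OF g uv(3,2)] uv(1) by (simp add: dist_real_def)
        then have "\<bar>f (u k)\<bar> * \<bar>g (v k) - g (u k)\<bar> \<le> \<bar>A\<bar> * (C * (v k - u k))"
          using bf[OF uv(2)] by (intro mult_mono) auto
        also have "\<dots> \<le> A' * (v k - u k)" using uv(1) by (simp add: A'_def algebra_simps)
        finally show "\<bar>f (u k)\<bar> * \<bar>g (v k) - g (u k)\<bar> \<le> A' * (v k - u k)" .
      qed
      finally show "norm (g (v k) * f (v k) - g (u k) * f (u k)) \<le>
          B' * norm (f (v k) - f (u k)) + A' * (v k - u k)" .
    qed
    also have "\<dots> = B' * (\<Sum>k<n. norm (f (v k) - f (u k))) + A' * (\<Sum>k<n. v k - u k)"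
      by (simp add: sum.distrib sum_distrib_left)
    also have "\<dots> < e / 2 + e / 2"
    proof (rule add_strict_mono)
      show "B' * (\<Sum>k<n. norm (f (v k) - f (u k))) < e / 2"
        using d(2)[OF *(2)] pos by (simp add: field_simps)
      show "A' * (\<Sum>k<n. v k - u k) < e / 2"
        using *(3) pos by (simp add: field_simps)
    qed
    finally show "(\<Sum>k<n. norm (g (v k) * f (v k) - g (u k) * f (u k))) < e" by simp
  qed
qed

lemma abs_continuous_on_affine:
  fixes f :: "real \<Rightarrow> real"
  assumes "abs_continuous_on S f"
  shows "abs_continuous_on S (\<lambda>x. c + s * f x)"
  using abs_continuous_on_bounded_linear[OF bounded_linear_mult_right[of s] assms]
  unfolding abs_continuous_on_iff by simp

text \<open>With the integrating factor \<open>exp (K * (t - a))\<close> the derivative of the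
  product is at least \<open>h\<close>, because the factor is at least 1 and
  \<open>D + K * z t \<ge> h t \<ge> 0\<close>. Integration over \<open>{a..b}\<close> gives the
  bound.\<close>

lemma gronwall_abs_continuous:
  fixes z h :: "real \<Rightarrow> real"
  assumes ab: "a \<le> b" and K: "K \<ge> 0"
    and ac: "abs_continuous_on {a..b} z" and cont: "continuous_on {a..b} z"
    and deriv: "AE t in lebesgue. t \<in> {a<..<b} \<longrightarrow>
          (\<exists>D. (z has_vector_derivative D) (at t) \<and> h t - K * z t \<le> D)"
    and h: "h integrable_on {a..b}" "\<And>t. t \<in> {a..b} \<Longrightarrow> 0 \<le> h t"
  shows "exp (- K * (b - a)) * (z a + integral {a..b} h) \<le> z b"
proof -
  obtain N where N: "negligible N"
      "{t. \<not> (t \<in> {a<..<b} \<longrightarrow> (\<exists>D. (z has_vector_derivative D) (at t) \<and> h t - K * z t \<le> D))} \<subseteq> N"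
    using deriv[unfolded eventually_ae_filter_negligible] by (elim exE conjE) (rule that)
  \<comment> \<open>The end points join the exceptional set, since the differential inequality is
    given on the open interval.\<close>
  define E where "E = N \<union> {a, b}"
  have E: "negligible E" using N(1) by (simp add: E_def negligible_Un)
  have "\<forall>t\<in>{a..b} - E. \<exists>D. (z has_vector_derivative D) (at t) \<and> h t - K * z t \<le> D"
  proof
    fix t assume "t \<in> {a..b} - E"
    then have "t \<in> {a<..<b}" "t \<notin> N" by (auto simp: E_def)
    then show "\<exists>D. (z has_vector_derivative D) (at t) \<and> h t - K * z t \<le> D"
      using N(2) by blast
  qed
  then obtain D where D: "\<And>t. t \<in> {a..b} - E \<Longrightarrow> (z has_vector_derivative D t) (at t) \<and> h t - K * z t \<le> D t"
    by metis
  define g where "g t = exp (K * (t - a))" for t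
  \<comment> \<open>The value \<open>h t\<close> on \<open>E\<close> makes \<open>h \<le> f'\<close>
    hold at every point of \<open>{a..b}\<close>, so the integrals can be compared directly.\<close>
  define f' where "f' t = (if t \<in> E then h t else g t * (D t + K * z t))" for t
  have dg: "(g has_real_derivative K * g t) (at t within S)" for t S
    unfolding g_def by (auto intro!: derivative_eq_intros)
  have g_ge1: "1 \<le> g t" if "t \<in> {a..b}" for t
    using that K by (simp add: g_def)
  have g_le: "g t \<le> g b" if "t \<in> {a..b}" for t
    using that K by (simp add: g_def mult_left_mono)
  have "(K * g b)-lipschitz_on {a..b} g"
  proof (rule bounded_derivative_imp_lipschitz[where f' = "\<lambda>t. (*) (K * g t)"])
    show "(g has_derivative (*) (K * g t)) (at t within {a..b})" for t
      using dg[of t "{a..b}"] by (simp add: has_field_derivative_def)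
    show "onorm ((*) (K * g t)) \<le> K * g b" if "t \<in> {a..b}" for t
      using K g_le[OF that] g_ge1[OF that]
      by (intro onorm_le) (simp add: abs_mult mult_mono)
  qed (use K ab g_ge1[of b] in auto)
  moreover obtain A where "\<And>t. t \<in> {a..b} \<Longrightarrow> \<bar>z t\<bar> \<le> A"
    using compact_imp_bounded[OF compact_continuous_image[OF cont compact_Icc]]
    unfolding bounded_iff by (metis imageI real_norm_def)
  moreover have "\<bar>g t\<bar> \<le> g b" if "t \<in> {a..b}" for t
    using g_le[OF that] g_ge1[OF that] by simp
  ultimately have "abs_continuous_on {a..b} (\<lambda>t. g t * z t)"
    using abs_continuous_on_lipschitz_mult[OF ac] by blast
  moreover have "((\<lambda>t. g t * z t) has_vector_derivative f' t) (at t within {a..b})" if "t \<in> {a..b} - E" for t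
  proof -
    have "(z has_real_derivative D t) (at t within {a..b})"
      using D[OF that] has_vector_derivative_at_within
      by (metis has_real_derivative_iff_has_vector_derivative)
    then have "((\<lambda>t. g t * z t) has_real_derivative K * g t * z t + D t * g t) (at t within {a..b})"
      by (rule DERIV_mult[OF dg])
    then show ?thesis
      using that by (simp add: f'_def has_real_derivative_iff_has_vector_derivative algebra_simps)
  qed
  ultimately have "(f' has_integral (g b * z b - g a * z a)) {a..b}"
    by (rule fundamental_theorem_of_calculus_abs_continuous[OF ab _ E])
  moreover have "h t \<le> f' t" if "t \<in> {a..b}" for t
  proof (cases "t \<in> E")
    case False
    then have "h t \<le> D t + K * z t" using D[of t] that by simp
    also have "\<dots> \<le> g t * (D t + K * z t)"
      using g_ge1[OF that] h(2)[OF that] \<open>h t \<le> D t + K * z t\<close>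
      by (metis mult_right_mono mult_1 order_trans)
    finally show ?thesis using False by (simp add: f'_def)
  qed (simp add: f'_def)
  ultimately have "integral {a..b} h \<le> g b * z b - g a * z a"
    using h(1) by (metis has_integral_le integrable_integral)
  then have "z a + integral {a..b} h \<le> g b * z b" by (simp add: g_def)
  then have "exp (- K * (b - a)) * (z a + integral {a..b} h) \<le> exp (- K * (b - a)) * (g b * z b)"
    by (rule mult_left_mono) simp
  also have "\<dots> = z b"
    by (simp add: g_def mult.assoc[symmetric] exp_add[symmetric])
  finally show ?thesis .
qed

section \<open>Scalar consensus with delays\<close>

text \<open>The weights are functions of time alone: the nonlinearity is evaluated along a given
  solution, and what remains is linear in \<open>z\<close>.\<close>

locale delayed_consensus =
  fixes V :: "'v set" and w delay :: "'v \<Rightarrow> 'v \<Rightarrow> real \<Rightarrow> real" and \<tau> K :: real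
    and z :: "'v \<Rightarrow> real \<Rightarrow> real"
  assumes finite_V: "finite V" and tau_nonneg: "\<tau> \<ge> 0" and K_nonneg: "K \<ge> 0"
    and delay: "\<And>i j t. i \<in> V \<Longrightarrow> j \<in> V \<Longrightarrow> t \<ge> 0 \<Longrightarrow> 0 \<le> delay i j t \<and> delay i j t \<le> \<tau>"
    and w_nonneg: "\<And>i j t. i \<in> V \<Longrightarrow> j \<in> V \<Longrightarrow> t \<ge> 0 \<Longrightarrow> 0 \<le> w i j t"
    and w_sum: "\<And>i t. i \<in> V \<Longrightarrow> t \<ge> 0 \<Longrightarrow> (\<Sum>j\<in>V - {i}. w i j t) \<le> K"
    and cont: "\<And>i. i \<in> V \<Longrightarrow> continuous_on {-\<tau>..} (z i)"
    and ac: "\<And>i. i \<in> V \<Longrightarrow> locally_abs_continuous_on {0..} (z i)"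
    and deriv: "AE t in lebesgue. t > 0 \<longrightarrow> (\<forall>i\<in>V. (z i has_vector_derivative
          (\<Sum>j\<in>V - {i}. w i j t * (z j (t - delay i j t) - z i t))) (at t))"
begin

text \<open>The weights multiply differences, so \<open>c\<close> cancels and \<open>s\<close>
  factors out. The case \<open>s = -1\<close> turns upper bounds into lower bounds.\<close>

lemma affine: "delayed_consensus V w delay \<tau> K (\<lambda>i t. c + s * z i t)"
proof
  show "continuous_on {-\<tau>..} (\<lambda>t. c + s * z i t)" if "i \<in> V" for i
    using cont[OF that] by (intro continuous_intros)
  show "locally_abs_continuous_on {0..} (\<lambda>t. c + s * z i t)" if "i \<in> V" for i
    using ac[OF that] abs_continuous_on_affine unfolding locally_abs_continuous_on_def by blast
  show "AE t in lebesgue. t > 0 \<longrightarrow> (\<forall>i\<in>V. ((\<lambda>t. c + s * z i t) has_vector_derivative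
          (\<Sum>j\<in>V - {i}. w i j t * (c + s * z j (t - delay i j t) - (c + s * z i t)))) (at t))"
    using deriv
  proof eventually_elim
    case (elim t)
    show ?case
    proof (intro impI ballI)
      fix i assume "0 < t" "i \<in> V"
      then have "(z i has_real_derivative (\<Sum>j\<in>V - {i}. w i j t * (z j (t - delay i j t) - z i t))) (at t)"
        using elim by (simp add: has_real_derivative_iff_has_vector_derivative)
      then have "((\<lambda>t. c + s * z i t) has_real_derivative
          s * (\<Sum>j\<in>V - {i}. w i j t * (z j (t - delay i j t) - z i t))) (at t)"
        by (auto intro!: derivative_eq_intros)
      also have "s * (\<Sum>j\<in>V - {i}. w i j t * (z j (t - delay i j t) - z i t)) =
          (\<Sum>j\<in>V - {i}. w i j t * (c + s * z j (t - delay i j t) - (c + s * z i t)))"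
        by (simp add: sum_distrib_left algebra_simps)
      finally show "((\<lambda>t. c + s * z i t) has_vector_derivative
          (\<Sum>j\<in>V - {i}. w i j t * (c + s * z j (t - delay i j t) - (c + s * z i t)))) (at t)"
        by (simp add: has_real_derivative_iff_has_vector_derivative)
    qed
  qed
qed (use finite_V tau_nonneg K_nonneg delay w_nonneg w_sum in auto)

text \<open>As \<open>z i\<close> is nonnegative and the row sum is at most \<open>K\<close>, the
  loss term is at most \<open>K * z i t\<close>, and Gronwall's inequality applies. \<open>h\<close>
  stands for an integrable part of the incoming terms that is to be retained.\<close>

lemma growth:
  assumes i: "i \<in> V" and ab: "0 \<le> a" "a \<le> b"
    and nonneg: "\<And>j s. j \<in> V \<Longrightarrow> s \<in> {a - \<tau>..b} \<Longrightarrow> 0 \<le> z j s"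
    and h: "h integrable_on {a..b}" "\<And>t. t \<in> {a..b} \<Longrightarrow> 0 \<le> h t"
      "\<And>t. t \<in> {a<..<b} \<Longrightarrow> h t \<le> (\<Sum>j\<in>V - {i}. w i j t * z j (t - delay i j t))"
  shows "exp (- K * (b - a)) * (z i a + integral {a..b} h) \<le> z i b"
proof (rule gronwall_abs_continuous[OF ab(2) K_nonneg _ _ _ h(1,2)])
  show "abs_continuous_on {a..b} (z i)"
    using ac[OF i] ab(1) by (auto simp: locally_abs_continuous_on_def)
  show "continuous_on {a..b} (z i)"
    using cont[OF i] ab(1) tau_nonneg by (elim continuous_on_subset) auto
  show "AE t in lebesgue. t \<in> {a<..<b} \<longrightarrow>
          (\<exists>D. (z i has_vector_derivative D) (at t) \<and> h t - K * z i t \<le> D)"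
    using deriv
  proof eventually_elim
    case (elim t)
    show ?case
    proof (intro impI exI conjI)
      assume t: "t \<in> {a<..<b}"
      then have "t > 0" using ab(1) by simp
      then show "(z i has_vector_derivative
          (\<Sum>j\<in>V - {i}. w i j t * (z j (t - delay i j t) - z i t))) (at t)"
        using elim i by blast
      have "0 \<le> z i t" using nonneg[OF i] t tau_nonneg by simp
      then have "(\<Sum>j\<in>V - {i}. w i j t) * z i t \<le> K * z i t"
        using w_sum[OF i] \<open>t > 0\<close> by (simp add: mult_right_mono)
      then show "h t - K * z i t \<le> (\<Sum>j\<in>V - {i}. w i j t * (z j (t - delay i j t) - z i t))"
        using h(3)[OF t] by (simp add: right_diff_distrib sum_subtractf sum_distrib_right)
    qed
  qed
qed

text \<open>The incoming terms are nonnegative, so \<open>growth\<close> applies with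
  \<open>h = 0\<close>.\<close>

lemma decay:
  assumes i: "i \<in> V" and ab: "0 \<le> a" "a \<le> b"
    and nonneg: "\<And>j s. j \<in> V \<Longrightarrow> s \<in> {a - \<tau>..b} \<Longrightarrow> 0 \<le> z j s"
  shows "exp (- K * (b - a)) * z i a \<le> z i b"
proof -
  have "0 \<le> (\<Sum>j\<in>V - {i}. w i j t * z j (t - delay i j t))" if t: "t \<in> {a<..<b}" for t
  proof (rule sum_nonneg)
    fix j assume "j \<in> V - {i}"
    then show "0 \<le> w i j t * z j (t - delay i j t)"
      using w_nonneg[of i j t] delay[of i j t] nonneg[of j "t - delay i j t"] i t ab(1) by auto
  qed
  then show ?thesis
    using growth[OF i ab nonneg, of "\<lambda>_. 0"] integrable_0[of "{a..b}"] by simp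
qed

text \<open>Until the first time at which some component vanishes all components are nonnegative, so that
  by \<open>decay\<close> none of them has reached zero.\<close>

lemma positive:
  assumes t0: "0 \<le> t0" and pos: "\<And>j s. j \<in> V \<Longrightarrow> s \<in> {t0 - \<tau>..t0} \<Longrightarrow> 0 < z j s"
    and i: "i \<in> V" and t: "t0 - \<tau> \<le> t"
  shows "0 < z i t"
proof (rule ccontr)
  assume "\<not> 0 < z i t"
  \<comment> \<open>The times at which some component is not positive form a finite union of closed
    sets, so a first such time exists.\<close>
  define B where "B = (\<Union>j\<in>V. {s \<in> {t0..}. z j s \<le> 0})"
  have "t \<in> B" using \<open>\<not> 0 < z i t\<close> i t pos[OF i, of t] by (force simp: B_def)
  have "closed {s \<in> {t0..}. z j s \<le> 0}" if "j \<in> V" for j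
  proof -
    have "continuous_on {t0..} (z j)"
      using cont[OF that] t0 tau_nonneg by (elim continuous_on_subset) auto
    then show ?thesis by (intro continuous_on_closed_Collect_le continuous_intros) auto
  qed
  then have "closed B" unfolding B_def using finite_V by (intro closed_UN) auto
  have bdd: "bdd_below B" by (auto simp: B_def bdd_below_def)
  define t1 where "t1 = Inf B"
  have "t1 \<in> B"
    unfolding t1_def using closed_contains_Inf[OF _ bdd \<open>closed B\<close>] \<open>t \<in> B\<close> by blast
  then obtain k where k: "k \<in> V" "t0 \<le> t1" "z k t1 \<le> 0" by (auto simp: B_def)
  have before: "0 < z j s" if "j \<in> V" "t0 - \<tau> \<le> s" "s < t1" for j s
  proof (rule ccontr)
    assume "\<not> 0 < z j s"
    then have "s \<in> B" using pos[OF \<open>j \<in> V\<close>, of s] that by (force simp: B_def)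
    then show False using cInf_lower[OF _ bdd] that(3) by (force simp: t1_def)
  qed
  have "t0 < t1" using k pos[OF k(1), of t0] tau_nonneg by (cases "t0 = t1") auto
  have "0 \<le> z j s" if "j \<in> V" "s \<in> {t0 - \<tau>..t1}" for j s
  proof (cases "s < t1")
    case False
    then have s: "s = t1" using that by simp
    \<comment> \<open>At \<open>t1\<close> itself nonnegativity follows by taking the left limit of
      the earlier positive values.\<close>
    have "continuous_on {t0..t1} (z j)"
      using cont[OF \<open>j \<in> V\<close>] t0 tau_nonneg by (elim continuous_on_subset) auto
    then have "(z j \<longlongrightarrow> z j t1) (at_left t1)"
      using \<open>t0 < t1\<close> by (simp add: continuous_on_Icc_at_leftD)
    moreover have "\<forall>\<^sub>F s in at_left t1. 0 \<le> z j s"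
      using eventually_at_left_real[OF \<open>t0 < t1\<close>]
      by eventually_elim (use before[OF \<open>j \<in> V\<close>] tau_nonneg in \<open>simp add: less_imp_le\<close>)
    ultimately show ?thesis
      unfolding s by (rule tendsto_lowerbound) simp
  qed (use before that in force)
  then have "exp (- K * (t1 - t0)) * z k t0 \<le> z k t1"
    using k t0 by (intro decay) auto
  moreover have "0 < exp (- K * (t1 - t0)) * z k t0"
    using pos[OF k(1), of t0] tau_nonneg by simp
  ultimately show False using k(3) by linarith
qed

text \<open>Adding \<open>e > 0\<close> to all components makes the history positive, so
  \<open>positive\<close> applies; then \<open>e\<close> is arbitrary.\<close>

lemma nonnegative:
  assumes t0: "0 \<le> t0" and nonneg: "\<And>j s. j \<in> V \<Longrightarrow> s \<in> {t0 - \<tau>..t0} \<Longrightarrow> 0 \<le> z j s"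
    and i: "i \<in> V" and t: "t0 - \<tau> \<le> t"
  shows "0 \<le> z i t"
proof (rule field_le_epsilon)
  fix e :: real assume "e > 0"
  interpret shift: delayed_consensus V w delay \<tau> K "\<lambda>i t. e + 1 * z i t"
    by (rule affine)
  have "0 < e + 1 * z i t"
    using t0 _ i t by (rule shift.positive) (use nonneg \<open>e > 0\<close> in force)
  then show "0 \<le> z i t + e" by simp
qed

end

section \<open>Persistent excitation\<close>

text \<open>Excitation is assumed for \<open>\<alpha>\<close> and passes to the weights through
  \<open>\<beta>\<close>, which will be a lower bound of the interaction along the solution.\<close>

locale excited_consensus = delayed_consensus V w delay \<tau> K z
  for V :: "'v set" and w delay :: "'v \<Rightarrow> 'v \<Rightarrow> real \<Rightarrow> real" and \<tau> K :: real
    and z :: "'v \<Rightarrow> real \<Rightarrow> real" +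
  fixes G :: "('v, 'b) pre_digraph" and \<alpha> :: "'v \<Rightarrow> 'v \<Rightarrow> real \<Rightarrow> real" and \<alpha>min \<beta> T :: real
  assumes verts_G: "verts G = V"
    and arcs_G: "\<And>i j. (i, j) \<in> arcs_ends G \<Longrightarrow> i \<in> V \<and> j \<in> V \<and> i \<noteq> j"
    and T_pos: "T > 0" and \<beta>_nonneg: "\<beta> \<ge> 0"
    and \<alpha>_nonneg: "\<And>i j t. (i, j) \<in> arcs_ends G \<Longrightarrow> t \<ge> 0 \<Longrightarrow> 0 \<le> \<alpha> i j t"
    and w_ge: "\<And>i j t. (i, j) \<in> arcs_ends G \<Longrightarrow> t \<ge> 0 \<Longrightarrow> \<beta> * \<alpha> i j t \<le> w i j t"
    and excitation: "\<And>i j t. (i, j) \<in> arcs_ends G \<Longrightarrow> t \<ge> 0 \<Longrightarrow>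
      \<alpha> i j integrable_on {t..t + T} \<and> \<alpha>min \<le> integral {t..t + T} (\<alpha> i j)"
begin

lemma excited_affine:
  "excited_consensus V w delay \<tau> K (\<lambda>i t. c + s * z i t) G \<alpha> \<alpha>min \<beta> T"
  using affine verts_G arcs_G T_pos \<beta>_nonneg \<alpha>_nonneg w_ge excitation
  by (auto simp: excited_consensus_def excited_consensus_axioms_def)

text \<open>Induction along the walk from its end \<open>l\<close>. Each arc costs a factor
  \<open>q\<close> and a time \<open>T + \<tau>\<close>: \<open>T\<close> to collect the excitation
  and \<open>\<tau>\<close> to wait for delayed information. The horizon \<open>L\<close> makes the
  decay of \<open>z l\<close> since \<open>t0\<close> a single factor
  \<open>exp (- K * L)\<close>.\<close>

lemma propagation:
  assumes t0: "0 \<le> t0" and nonneg: "\<And>j s. j \<in> V \<Longrightarrow> s \<in> {t0 - \<tau>..t0} \<Longrightarrow> 0 \<le> z j s"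
    and q: "0 \<le> q" "q \<le> exp (- K * T) * \<beta> * \<alpha>min"
    and c: "0 \<le> c" "c \<le> z l t0"
    and p: "vwalk p G" "last p = l"
    and t: "t \<in> {t0 + real (length p - 1) * (T + \<tau>)..t0 + L}"
  shows "q ^ (length p - 1) * (exp (- K * L) * c) \<le> z (hd p) t"
  using p t
proof (induction p arbitrary: t)
  case (Base u)
  then have "u \<in> V" "u = l" "t0 \<le> t" "t \<le> t0 + L" using verts_G by auto
  then have "exp (- K * (t - t0)) * z u t0 \<le> z u t"
    using nonnegative[OF t0 nonneg] t0 by (intro decay) auto
  moreover have "exp (- K * L) * c \<le> exp (- K * (t - t0)) * z u t0"
    using K_nonneg c \<open>t \<le> t0 + L\<close> \<open>u = l\<close>
    by (intro mult_mono) (auto intro: mult_left_mono)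
  ultimately show ?case by simp
next
  case (Cons u v es)
  define A where "A = q ^ length es * (exp (- K * L) * c)"
  have "A \<ge> 0" using q c by (simp add: A_def)
  have uv: "u \<in> V" "v \<in> V" "u \<noteq> v" using arcs_G[OF Cons.hyps] by auto
  \<comment> \<open>The window \<open>{t - T..t}\<close> starts at least \<open>\<tau>\<close> after
    the bound on \<open>z v\<close> sets in, so delayed times in this window stay within the range
    of the induction hypothesis.\<close>
  have t: "t0 + real (length es) * (T + \<tau>) + \<tau> \<le> t - T" "t \<le> t0 + L"
    using Cons.prems(2) by (auto simp: algebra_simps)
  have v: "A \<le> z v s" if "s \<in> {t0 + real (length es) * (T + \<tau>)..t0 + L}" for s
    using Cons.IH[of s] Cons.prems(1) that by (simp add: A_def)
  have start: "t0 + \<tau> \<le> t - T"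
  proof -
    have "0 \<le> real (length es) * (T + \<tau>)" using T_pos tau_nonneg by simp
    then show ?thesis using t(1) by linarith
  qed
  have exc: "\<alpha> u v integrable_on {t - T..t}" "\<alpha>min \<le> integral {t - T..t} (\<alpha> u v)"
    using excitation[OF Cons.hyps, of "t - T"] start t0 tau_nonneg by auto
  have later: "0 \<le> z j s" if "j \<in> V" "t0 - \<tau> \<le> s" for j s
    using nonnegative[OF t0 nonneg that] .
  \<comment> \<open>Of all incoming terms only the one of the arc \<open>(u, v)\<close> is retained,
    with \<open>z v\<close> replaced by its lower bound \<open>A\<close>.\<close>
  define h where "h s = A * \<beta> * \<alpha> u v s" for s
  have "exp (- K * (t - (t - T))) * (z u (t - T) + integral {t - T..t} h) \<le> z u t"
  proof (rule growth[OF uv(1)])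
    show "0 \<le> t - T" "t - T \<le> t" using start t0 tau_nonneg T_pos by auto
    show "0 \<le> z j s" if "j \<in> V" "s \<in> {t - T - \<tau>..t}" for j s
      using later[of j s] that start tau_nonneg by auto
    show "h integrable_on {t - T..t}"
      unfolding h_def using exc(1) by (rule integrable_on_mult_right)
    show "0 \<le> h s" if "s \<in> {t - T..t}" for s
      using \<open>A \<ge> 0\<close> \<beta>_nonneg \<alpha>_nonneg[OF Cons.hyps, of s] that start t0 tau_nonneg
      by (simp add: h_def)
    show "h s \<le> (\<Sum>j\<in>V - {u}. w u j s * z j (s - delay u j s))" if s: "s \<in> {t - T<..<t}" for s
    proof -
      have s0: "0 \<le> s" using s start t0 tau_nonneg by auto
      have d: "0 \<le> delay u j s \<and> delay u j s \<le> \<tau>" if "j \<in> V" for j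
        using delay[OF uv(1) that s0] .
      have "A \<le> z v (s - delay u v s)"
        using v[of "s - delay u v s"] d[OF uv(2)] s t by auto
      moreover have "h s = \<beta> * \<alpha> u v s * A" by (simp add: h_def)
      ultimately have "h s \<le> w u v s * z v (s - delay u v s)"
        using w_ge[OF Cons.hyps s0] \<open>A \<ge> 0\<close> w_nonneg[OF uv(1,2) s0] by (simp add: mult_mono)
      also have "\<dots> \<le> (\<Sum>j\<in>V - {u}. w u j s * z j (s - delay u j s))"
      proof (rule member_le_sum)
        fix j assume "j \<in> V - {u} - {v}"
        then show "0 \<le> w u j s * z j (s - delay u j s)"
          using w_nonneg[OF uv(1) _ s0, of j] later[of j "s - delay u j s"] d[of j] s start
            tau_nonneg by auto
      qed (use uv finite_V in auto)
      finally show ?thesis .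
    qed
  qed
  moreover have "integral {t - T..t} h = A * \<beta> * integral {t - T..t} (\<alpha> u v)"
    unfolding h_def by simp
  moreover have "0 \<le> z u (t - T)" using later[OF uv(1)] start tau_nonneg by simp
  \<comment> \<open>The bound required of \<open>q\<close> is exactly the gain over one excitation
    window.\<close>
  moreover have "q * A \<le> exp (- K * T) * (A * \<beta> * integral {t - T..t} (\<alpha> u v))"
  proof -
    have "q * A \<le> exp (- K * T) * \<beta> * \<alpha>min * A"
      using q \<open>A \<ge> 0\<close> by (simp add: mult_right_mono)
    also have "\<dots> = exp (- K * T) * (A * \<beta> * \<alpha>min)" by simp
    also have "\<dots> \<le> exp (- K * T) * (A * \<beta> * integral {t - T..t} (\<alpha> u v))"
      using exc(2) \<open>A \<ge> 0\<close> \<beta>_nonneg by (intro mult_left_mono) auto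
    finally show ?thesis .
  qed
  ultimately have "q * A \<le> z u t"
    by (simp add: distrib_left) (smt (verit) exp_gt_zero mult_nonneg_nonneg)
  then show ?case by (simp add: A_def mult.assoc)
qed

text \<open>Because \<open>q \<le> 1\<close>, a walk with fewer than \<open>n\<close> arcs gives an
  even better factor, and its bound holds from an earlier time on. Hence one estimate serves all
  start vertices.\<close>

lemma lower_bound:
  assumes t0: "0 \<le> t0" and nonneg: "\<And>j s. j \<in> V \<Longrightarrow> s \<in> {t0 - \<tau>..t0} \<Longrightarrow> 0 \<le> z j s"
    and q: "0 \<le> q" "q \<le> 1" "q \<le> exp (- K * T) * \<beta> * \<alpha>min"
    and c: "0 \<le> c" "c \<le> z l t0"
    and p: "vwalk p G" "hd p = i" "last p = l" "length p - 1 \<le> n"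
    and t: "t \<in> {t0 + real n * (T + \<tau>)..t0 + L}"
  shows "q ^ n * (exp (- K * L) * c) \<le> z i t"
proof -
  have "real (length p - 1) * (T + \<tau>) \<le> real n * (T + \<tau>)"
    using p(4) T_pos tau_nonneg by (intro mult_right_mono) auto
  then have "q ^ (length p - 1) * (exp (- K * L) * c) \<le> z (hd p) t"
    using t by (intro propagation[OF t0 nonneg q(1,3) c p(1,3)]) auto
  moreover have "q ^ n * (exp (- K * L) * c) \<le> q ^ (length p - 1) * (exp (- K * L) * c)"
    using p(4) q c(1) by (intro mult_right_mono power_decreasing) auto
  ultimately show ?thesis unfolding p(2) by linarith
qed

text \<open>At time \<open>t0\<close> the component \<open>l\<close> is far from one end of the interval \<open>{0..D}\<close>. Along the walks
  ending in \<open>l\<close> it pulls every other component away from that end.\<close>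

lemma oscillation_contraction:
  assumes t0: "0 \<le> t0" and bounds: "\<And>j s. j \<in> V \<Longrightarrow> s \<in> {t0 - \<tau>..t0} \<Longrightarrow> 0 \<le> z j s \<and> z j s \<le> D"
    and q: "0 \<le> q" "q \<le> 1" "q \<le> exp (- K * T) * \<beta> * \<alpha>min"
    and l: "l \<in> V"
    and walks: "\<And>i. i \<in> V \<Longrightarrow> \<exists>p. vwalk p G \<and> hd p = i \<and> last p = l \<and> length p - 1 \<le> n"
    and ij: "i \<in> V" "j \<in> V"
    and rs: "r \<in> {t0 + real n * (T + \<tau>)..t0 + L}" "s \<in> {t0 + real n * (T + \<tau>)..t0 + L}"
  shows "z i r - z j s \<le> (1 - q ^ n * exp (- K * L) / 2) * D"
proof -
  interpret neg: excited_consensus V w delay \<tau> K "\<lambda>i t. D + (- 1) * z i t" G \<alpha> \<alpha>min \<beta> T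
    by (rule excited_affine)
  have zl: "0 \<le> z l t0" "z l t0 \<le> D" using bounds[OF l, of t0] tau_nonneg by auto
  have ge: "t0 \<le> r" "t0 \<le> s"
    using rs T_pos tau_nonneg by (auto intro: order_trans[rotated])
  have lo: "0 \<le> z k t" if "k \<in> V" "t0 - \<tau> \<le> t" for k t
    using nonnegative[OF t0 _ that] bounds by blast
  have hi: "0 \<le> D + (- 1) * z k t" if "k \<in> V" "t0 - \<tau> \<le> t" for k t
    by (rule neg.nonnegative[OF t0 _ that]) (use bounds in auto)
  \<comment> \<open>Comparison with the midpoint of \<open>{0..D}\<close> decides which end is left
    behind and causes the division by 2 in the contraction factor. The reflected system
    \<open>neg\<close> handles the upper end.\<close>
  have "D / 2 \<le> z l t0 \<or> D / 2 \<le> D + (- 1) * z l t0" by linarith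
  then show ?thesis
  proof
    assume l2: "D / 2 \<le> z l t0"
    obtain p where "vwalk p G" "hd p = j" "last p = l" "length p - 1 \<le> n"
      using walks[OF ij(2)] by blast
    then have "q ^ n * (exp (- K * L) * (D / 2)) \<le> z j s"
      using l2 zl bounds rs(2) by (intro lower_bound[OF t0 _ q]) auto
    then show ?thesis
      using hi[OF ij(1), of r] ge tau_nonneg by (simp add: algebra_simps)
  next
    assume l2: "D / 2 \<le> D + (- 1) * z l t0"
    obtain p where "vwalk p G" "hd p = i" "last p = l" "length p - 1 \<le> n"
      using walks[OF ij(1)] by blast
    then have "q ^ n * (exp (- K * L) * (D / 2)) \<le> D + (- 1) * z i r"
      using l2 zl bounds rs(1) by (intro neg.lower_bound[OF t0 _ q]) auto
    then show ?thesis
      using lo[OF ij(2), of s] ge tau_nonneg by (simp add: algebra_simps)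
  qed
qed

end

section \<open>The vector-valued system\<close>

text \<open>Strong connectivity provides some path, so the least length in
  \<open>digraph_dist\<close> is attained; the number of arcs is
  \<open>length p - 1\<close>.\<close>

lemma (in pair_digraph) vwalk_le_digraph_depth:
  assumes sc: "strongly_connected (with_proj G)" and "i \<in> pverts G" "j \<in> pverts G"
  obtains p where "vwalk p (with_proj G)" "hd p = i" "last p = j" "length p - 1 \<le> digraph_depth G"
proof -
  define P where "P n \<longleftrightarrow> (\<exists>p. vpath p (with_proj G) \<and> hd p = i \<and> last p = j \<and> vwalk_length p = n)" for n
  have "i \<rightarrow>\<^sup>*\<^bsub>with_proj G\<^esub> j"
    using sc assms(2,3) by (auto simp: strongly_connected_def)
  then have "\<exists>n. P n" by (auto simp: P_def reachable_vpath_conv)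
  then have "P (digraph_dist G i j)"
    unfolding digraph_dist_def P_def[symmetric] by (rule LeastI_ex)
  then obtain p where p: "vpath p (with_proj G)" "hd p = i" "last p = j"
      "length p - 1 = digraph_dist G i j"
    by (auto simp: P_def)
  have "digraph_dist G i j \<le> digraph_depth G"
    unfolding digraph_depth_def using assms(2,3) pair_finite_verts
    by (intro Max_ge) (auto intro!: finite_imageI rev_image_eqI[of "(i, j)"])
  then show thesis using p by (intro that[of p]) (auto simp: vpath_def)
qed

text \<open>A bound instead of a supremum: contraction estimates can be iterated without showing
  boundedness each time.\<close>

definition history_diam_le :: "'v set \<Rightarrow> real \<Rightarrow> ('v \<Rightarrow> real \<Rightarrow> 'a::real_normed_vector) \<Rightarrow> real \<Rightarrow> real \<Rightarrow> bool" where
  "history_diam_le V \<tau> x t D \<longleftrightarrow>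
     (\<forall>i\<in>V. \<forall>j\<in>V. \<forall>r\<in>{t - \<tau>..t}. \<forall>s\<in>{t - \<tau>..t}. norm (x i r - x j s) \<le> D)"

lemma inner_sgn_self: "sgn v \<bullet> v = norm v" for v :: "'a::real_inner"
  by (cases "v = 0") (simp_all add: sgn_div_norm power2_norm_eq_inner[symmetric] power2_eq_square)

text \<open>By Cauchy-Schwarz any two values of the projection differ by at most \<open>D\<close>,
  so all lie within \<open>D\<close> above their infimum.\<close>

lemma inner_history_interval:
  fixes x :: "'v \<Rightarrow> real \<Rightarrow> 'a::real_inner"
  assumes osc: "history_diam_le V \<tau> x t D" and v: "norm v \<le> 1"
    and "V \<noteq> {}" "\<tau> \<ge> 0"
  obtains m where "\<And>i s. i \<in> V \<Longrightarrow> s \<in> {t - \<tau>..t} \<Longrightarrow> m \<le> v \<bullet> x i s \<and> v \<bullet> x i s \<le> m + D"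
proof -
  define X where "X = (\<lambda>(i, s). v \<bullet> x i s) ` (V \<times> {t - \<tau>..t})"
  have "X \<noteq> {}" using assms(3,4) by (auto simp: X_def)
  have diff: "a - b \<le> D" if "a \<in> X" "b \<in> X" for a b
  proof -
    obtain i r j s where *: "i \<in> V" "j \<in> V" "r \<in> {t - \<tau>..t}" "s \<in> {t - \<tau>..t}"
        "a = v \<bullet> x i r" "b = v \<bullet> x j s"
      using \<open>a \<in> X\<close> \<open>b \<in> X\<close> by (auto simp: X_def)
    have "a - b = v \<bullet> (x i r - x j s)" by (simp add: * inner_diff_right)
    also have "\<dots> \<le> norm v * norm (x i r - x j s)" by (rule norm_cauchy_schwarz)
    also have "\<dots> \<le> 1 * norm (x i r - x j s)" using v by (rule mult_right_mono) simp
    also have "\<dots> \<le> D" using osc * by (simp add: history_diam_le_def)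
    finally show ?thesis .
  qed
  obtain b where "b \<in> X" using \<open>X \<noteq> {}\<close> by blast
  then have "bdd_below X" using diff[of b] by (intro bdd_belowI[of _ "b - D"]) (simp add: le_diff_eq diff_le_eq add.commute)
  then have lower: "Inf X \<le> a" if "a \<in> X" for a using cInf_lower[OF that] by blast
  have upper: "a \<le> Inf X + D" if "a \<in> X" for a
    using cInf_greatest[OF \<open>X \<noteq> {}\<close>, of "a - D"] diff[OF that] by fastforce
  show thesis
  proof (rule that)
    fix i s assume "i \<in> V" "s \<in> {t - \<tau>..t}"
    then have "v \<bullet> x i s \<in> X" by (force simp: X_def)
    then show "Inf X \<le> v \<bullet> x i s \<and> v \<bullet> x i s \<le> Inf X + D" using lower upper by blast
  qed
qed

text \<open>Project onto the direction of \<open>x i t\<close> at the fixed time \<open>t\<close>: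
  the projection is at most \<open>R\<close> on the history, hence forever, and at time
  \<open>t\<close> it equals the norm.\<close>

lemma delayed_consensus_norm_le:
  fixes x :: "'v \<Rightarrow> real \<Rightarrow> 'a::real_inner"
  assumes dc: "\<And>v. delayed_consensus V w delay \<tau> K (\<lambda>i t. v \<bullet> x i t)"
    and hist: "\<And>j s. j \<in> V \<Longrightarrow> s \<in> {-\<tau>..0} \<Longrightarrow> norm (x j s) \<le> R"
    and i: "i \<in> V" and t: "-\<tau> \<le> t"
  shows "norm (x i t) \<le> R"
proof -
  define v where "v = sgn (x i t)"
  have v: "norm v \<le> 1" by (simp add: v_def norm_sgn)
  interpret delayed_consensus V w delay \<tau> K "\<lambda>i t. R + (- 1) * (v \<bullet> x i t)"
    by (rule delayed_consensus.affine[OF dc])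
  have "0 \<le> R + (- 1) * (v \<bullet> x i t)"
  proof (rule nonnegative[OF order_refl _ i])
    fix j s assume js: "j \<in> V" "s \<in> {0 - \<tau>..0}"
    have "v \<bullet> x j s \<le> norm v * norm (x j s)" by (rule norm_cauchy_schwarz)
    also have "\<dots> \<le> 1 * norm (x j s)" using v by (rule mult_right_mono) simp
    finally show "0 \<le> R + (- 1) * (v \<bullet> x j s)" using hist[of j s] js by simp
  qed (use t in simp)
  moreover have "v \<bullet> x i t = norm (x i t)"
    by (simp add: v_def inner_sgn_self)
  ultimately show ?thesis by simp
qed

text \<open>In the direction of \<open>x i t - x j t\<close> the history lies in an interval of
  length \<open>D\<close>, and neither end of it can be crossed later.\<close>

lemma delayed_consensus_diam_le:
  fixes x :: "'v \<Rightarrow> real \<Rightarrow> 'a::real_inner"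
  assumes dc: "\<And>v. delayed_consensus V w delay \<tau> K (\<lambda>i t. v \<bullet> x i t)"
    and t0: "0 \<le> t0" and osc: "history_diam_le V \<tau> x t0 D"
    and ij: "i \<in> V" "j \<in> V" and t: "t0 \<le> t"
  shows "norm (x i t - x j t) \<le> D"
proof -
  define v where "v = sgn (x i t - x j t)"
  have v: "norm v \<le> 1" by (simp add: v_def norm_sgn)
  have \<tau>: "\<tau> \<ge> 0" using delayed_consensus.tau_nonneg[OF dc] .
  obtain m where m: "\<And>i s. i \<in> V \<Longrightarrow> s \<in> {t0 - \<tau>..t0} \<Longrightarrow> m \<le> v \<bullet> x i s \<and> v \<bullet> x i s \<le> m + D"
    using inner_history_interval[OF osc v _ \<tau>] ij by blast
  have "0 \<le> - m + 1 * (v \<bullet> x j t)"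
    by (rule delayed_consensus.nonnegative[OF delayed_consensus.affine[OF dc] t0 _ ij(2)])
       (use m t \<tau> in force)+
  moreover have "0 \<le> (m + D) + (- 1) * (v \<bullet> x i t)"
    by (rule delayed_consensus.nonnegative[OF delayed_consensus.affine[OF dc] t0 _ ij(1)])
       (use m t \<tau> in force)+
  moreover have "v \<bullet> x i t - v \<bullet> x j t = norm (x i t - x j t)"
    by (simp add: v_def inner_sgn_self flip: inner_diff_right)
  ultimately show ?thesis by simp
qed

text \<open>Project onto the direction of the difference and shift the history into
  \<open>{0..D}\<close>. The choice of \<open>L\<close> makes the new history window begin just when
  \<open>n\<close> arcs have been traversed.\<close>

lemma excited_consensus_contraction:
  fixes x :: "'v \<Rightarrow> real \<Rightarrow> 'a::real_inner"
  assumes ec: "\<And>v. excited_consensus V w delay \<tau> K (\<lambda>i t. v \<bullet> x i t) G \<alpha> \<alpha>min \<beta> T"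
    and t0: "0 \<le> t0" and osc: "history_diam_le V \<tau> x t0 D"
    and q: "0 \<le> q" "q \<le> 1" "q \<le> exp (- K * T) * \<beta> * \<alpha>min"
    and l: "l \<in> V"
    and walks: "\<And>i. i \<in> V \<Longrightarrow> \<exists>p. vwalk p G \<and> hd p = i \<and> last p = l \<and> length p - 1 \<le> n"
    and L: "L = real n * (T + \<tau>) + \<tau>"
  shows "history_diam_le V \<tau> x (t0 + L) ((1 - q ^ n * exp (- K * L) / 2) * D)"
  unfolding history_diam_le_def
proof (intro ballI)
  fix i j r s assume ij: "i \<in> V" "j \<in> V" and rs: "r \<in> {t0 + L - \<tau>..t0 + L}" "s \<in> {t0 + L - \<tau>..t0 + L}"
  define v where "v = sgn (x i r - x j s)"
  have v: "norm v \<le> 1" by (simp add: v_def norm_sgn)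
  have \<tau>: "\<tau> \<ge> 0" using delayed_consensus.tau_nonneg[OF excited_consensus.axioms(1)[OF ec]] .
  obtain m where m: "\<And>i s. i \<in> V \<Longrightarrow> s \<in> {t0 - \<tau>..t0} \<Longrightarrow> m \<le> v \<bullet> x i s \<and> v \<bullet> x i s \<le> m + D"
    using inner_history_interval[OF osc v _ \<tau>] ij by blast
  interpret excited_consensus V w delay \<tau> K "\<lambda>i t. - m + 1 * (v \<bullet> x i t)" G \<alpha> \<alpha>min \<beta> T
    by (rule excited_consensus.excited_affine[OF ec])
  have "(- m + 1 * (v \<bullet> x i r)) - (- m + 1 * (v \<bullet> x j s)) \<le> (1 - q ^ n * exp (- K * L) / 2) * D"
    by (rule oscillation_contraction[OF t0 _ q l walks ij]) (use m rs L in force)+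
  moreover have "v \<bullet> x i r - v \<bullet> x j s = norm (x i r - x j s)"
    by (simp add: v_def inner_sgn_self flip: inner_diff_right)
  ultimately show "norm (x i r - x j s) \<le> (1 - q ^ n * exp (- K * L) / 2) * D" by simp
qed

text \<open>The factor \<open>1 / (real N - 1)\<close> in \<open>interaction\<close> balances the
  \<open>N - 1\<close> neighbours, so the row sums are at most \<open>K\<close>. The inner product
  with \<open>v\<close> commutes with the derivative.\<close>

lemma is_solution_delayed_consensus:
  fixes x :: "nat \<Rightarrow> real \<Rightarrow> real^'d"
  assumes sol: "is_solution N G \<psi> \<alpha> delay \<tau> x0 x" and N: "N \<ge> 2" and "\<tau> > 0"
    and delay: "\<And>i j t. i \<in> {1..N} \<Longrightarrow> j \<in> {1..N} \<Longrightarrow> t \<ge> 0 \<Longrightarrow> 0 \<le> delay i j t \<and> delay i j t \<le> \<tau>"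
    and \<psi>: "\<And>z. 0 < \<psi> z" "\<And>z. \<psi> z \<le> K"
    and \<alpha>: "\<And>i j t. i \<in> {1..N} \<Longrightarrow> j \<in> {1..N} \<Longrightarrow> t \<ge> 0 \<Longrightarrow> 0 \<le> \<alpha> i j t \<and> \<alpha> i j t \<le> 1"
  shows "delayed_consensus {1..N}
    (\<lambda>i j t. arc_indicator G i j * \<alpha> i j t * interaction N \<psi> delay x i j t) delay \<tau> K (\<lambda>i t. v \<bullet> x i t)"
    (is "delayed_consensus _ ?w _ _ _ _")
proof
  have arc: "0 \<le> arc_indicator G i j" "arc_indicator G i j \<le> 1" for i j
    by (auto simp: arc_indicator_def)
  have int: "0 \<le> interaction N \<psi> delay x i j t" "interaction N \<psi> delay x i j t \<le> K / (real N - 1)" for i j t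
    using \<psi> N by (auto simp: interaction_def less_imp_le divide_right_mono)
  show "0 \<le> ?w i j t" if "i \<in> {1..N}" "j \<in> {1..N}" "0 \<le> t" for i j t
    using \<alpha>[OF that] arc int by simp
  show "0 \<le> K" using \<psi> by (meson less_imp_le order_trans)
  show "(\<Sum>j\<in>{1..N} - {i}. ?w i j t) \<le> K" if i: "i \<in> {1..N}" and t: "0 \<le> t" for i t
  proof -
    have "?w i j t \<le> K / (real N - 1)" if "j \<in> {1..N} - {i}" for j
    proof -
      have "?w i j t \<le> 1 * 1 * (K / (real N - 1))"
        using \<alpha>[OF i _ t, of j] arc int that by (intro mult_mono) auto
      then show ?thesis by simp
    qed
    then have "(\<Sum>j\<in>{1..N} - {i}. ?w i j t) \<le> real (card ({1..N} - {i})) * (K / (real N - 1))"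
      by (rule sum_bounded_above)
    also have "\<dots> = K" using i N by (simp add: of_nat_diff)
    finally show ?thesis .
  qed
  show "continuous_on {- \<tau>..} (\<lambda>t. v \<bullet> x i t)" if "i \<in> {1..N}" for i
    using sol that by (auto simp: is_solution_def intro!: continuous_intros)
  show "locally_abs_continuous_on {0..} (\<lambda>t. v \<bullet> x i t)" if "i \<in> {1..N}" for i
    using sol that abs_continuous_on_bounded_linear[OF bounded_linear_inner_right]
    unfolding is_solution_def locally_abs_continuous_on_def by blast
  have "AE t in lebesgue. t > 0 \<longrightarrow> (\<forall>i\<in>{1..N}. (x i has_vector_derivative
      (\<Sum>j\<in>{1..N} - {i}. ?w i j t *\<^sub>R (x j (t - delay i j t) - x i t))) (at t))"
    using sol unfolding is_solution_def by blast
  then show "AE t in lebesgue. t > 0 \<longrightarrow> (\<forall>i\<in>{1..N}. ((\<lambda>t. v \<bullet> x i t) has_vector_derivative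
      (\<Sum>j\<in>{1..N} - {i}. ?w i j t * (v \<bullet> x j (t - delay i j t) - v \<bullet> x i t))) (at t))"
  proof eventually_elim
    case (elim t)
    show ?case
    proof (intro impI ballI)
      fix i assume "0 < t" "i \<in> {1..N}"
      then have "(x i has_vector_derivative
          (\<Sum>j\<in>{1..N} - {i}. ?w i j t *\<^sub>R (x j (t - delay i j t) - x i t))) (at t)"
        using elim by blast
      from bounded_linear.has_vector_derivative[OF bounded_linear_inner_right this, of v]
      show "((\<lambda>t. v \<bullet> x i t) has_vector_derivative
          (\<Sum>j\<in>{1..N} - {i}. ?w i j t * (v \<bullet> x j (t - delay i j t) - v \<bullet> x i t))) (at t)"
        by (simp add: inner_sum_right inner_diff_right)
    qed
  qed
qed (use delay \<open>\<tau> > 0\<close> in auto)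

text \<open>Passes from the Lebesgue integral of the excitation condition to the gauge integral used
  in the scalar estimates.\<close>

lemma set_lebesgue_integral_bounded:
  fixes f :: "real \<Rightarrow> real"
  assumes f: "f \<in> borel_measurable (lebesgue_on S)" and "{a..b} \<subseteq> S"
    and bound: "\<And>s. s \<in> {a..b} \<Longrightarrow> \<bar>f s\<bar> \<le> B"
  shows "f integrable_on {a..b}" "(LINT s:{a..b}|lebesgue. f s) = integral {a..b} f"
proof -
  have "f \<in> borel_measurable (lebesgue_on {a..b})"
    using f \<open>{a..b} \<subseteq> S\<close> by (rule measurable_restrict_mono)
  then have "f absolutely_integrable_on {a..b}"
    by (rule measurable_bounded_by_integrable_imp_absolutely_integrable[where g = "\<lambda>_. B"])
       (use bound in auto)
  then show "f integrable_on {a..b}" "(LINT s:{a..b}|lebesgue. f s) = integral {a..b} f"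
    using set_lebesgue_integral_eq_integral by blast+
qed

text \<open>The bound \<open>R\<close> makes the supremum run over a bounded set, so it dominates
  each of its members.\<close>

lemma history_diam_le_history_diam:
  fixes x :: "nat \<Rightarrow> real \<Rightarrow> real^'d"
  assumes "\<And>i s. i \<in> {1..N} \<Longrightarrow> s \<in> {-\<tau>..0} \<Longrightarrow> norm (x i s) \<le> R"
  shows "history_diam_le {1..N} \<tau> x 0 (history_diam N \<tau> x)"
  unfolding history_diam_le_def
proof (intro ballI)
  fix i j r s assume ij: "i \<in> {1..N}" "j \<in> {1..N}" and rs: "r \<in> {0 - \<tau>..0}" "s \<in> {0 - \<tau>..0}"
  define F where "F i j = (SUP (r, s) \<in> {-\<tau>..0} \<times> {-\<tau>..0}. norm (x i r - x j s))" for i j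
  have "norm (x i r' - x j s') \<le> R + R" if "r' \<in> {-\<tau>..0}" "s' \<in> {-\<tau>..0}" for r' s'
    using assms[OF ij(1) that(1)] assms[OF ij(2) that(2)] norm_triangle_ineq4[of "x i r'" "x j s'"] by linarith
  then have "bdd_above ((\<lambda>(r, s). norm (x i r - x j s)) ` ({-\<tau>..0} \<times> {-\<tau>..0}))"
    by (intro bdd_aboveI[of _ "R + R"]) auto
  then have "(\<lambda>(r, s). norm (x i r - x j s)) (r, s) \<le> F i j"
    unfolding F_def using rs by (intro cSUP_upper) auto
  moreover have "F i j \<le> history_diam N \<tau> x"
    unfolding history_diam_def F_def[symmetric] using ij
    by (intro Max_ge) (auto intro!: finite_imageI rev_image_eqI[of "(i, j)"])
  ultimately show "norm (x i r - x j s) \<le> history_diam N \<tau> x" by simp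
qed

theorem theorem2p1:
  fixes N \<gamma> :: nat
    and \<tau> T \<alpha>min :: real
    and G :: "nat pair_pre_digraph"
    and delay \<alpha> :: "nat \<Rightarrow> nat \<Rightarrow> real \<Rightarrow> real"
    and \<psi> :: "(real^'d) \<times> (real^'d) \<Rightarrow> real"
    and x0 :: "nat \<Rightarrow> real \<Rightarrow> real^'d"
  assumes "N \<ge> 2"
    and "\<tau> > 0"
    and "pair_digraph G"
    and "pverts G = {1..N}"
    and "strongly_connected (with_proj G)"
    and "\<gamma> = digraph_depth G"
    and "\<And>i j. i \<in> {1..N} \<Longrightarrow> j \<in> {1..N} \<Longrightarrow> continuous_on {0..} (delay i j)"
    and "\<And>i j t. i \<in> {1..N} \<Longrightarrow> j \<in> {1..N} \<Longrightarrow> t \<ge> 0 \<Longrightarrow> 0 \<le> delay i j t \<and> delay i j t \<le> \<tau>"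
    and "continuous_on UNIV \<psi>"
    and "\<And>z. \<psi> z > 0"
    and "bounded (range \<psi>)"
    and "\<And>i j. i \<in> {1..N} \<Longrightarrow> j \<in> {1..N} \<Longrightarrow> \<alpha> i j \<in> borel_measurable (lebesgue_on {0..})"
    and "\<And>i j t. i \<in> {1..N} \<Longrightarrow> j \<in> {1..N} \<Longrightarrow> t \<ge> 0 \<Longrightarrow> 0 \<le> \<alpha> i j t \<and> \<alpha> i j t \<le> 1"
    and "T > 0"
    and "\<alpha>min > 0"
    and "\<And>i j t. i \<in> {1..N} \<Longrightarrow> j \<in> {1..N} \<Longrightarrow> arc_indicator G i j = 1 \<Longrightarrow> t \<ge> 0 \<Longrightarrow>
           (LINT s:{t..t+T}|lebesgue. \<alpha> i j s) \<ge> \<alpha>min"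
    and "\<And>i. i \<in> {1..N} \<Longrightarrow> continuous_on {-\<tau>..0} (x0 i)"
  shows "\<exists>C>0. \<forall>x. is_solution N G \<psi> \<alpha> delay \<tau> x0 x \<longrightarrow>
           (\<forall>t\<ge>0. diam_at N x t \<le> history_diam N \<tau> x * exp (- C * (t - real \<gamma> * (T + \<tau>) - \<tau>)))"
proof -
  note N = assms(1) and \<tau> = assms(2) and G = assms(3) and VG = assms(4) and delay = assms(8)
    and \<alpha> = assms(13)
  interpret pair_digraph G by (rule G)
  obtain K where "\<forall>y\<in>range \<psi>. norm y \<le> K"
    using assms(11) unfolding bounded_iff by blast
  then have K: "\<psi> z \<le> K" for z by (cases z) (auto simp: abs_le_iff)
  \<comment> \<open>All constants come from the data before any solution is fixed, so that
    \<open>C\<close> is the same for every solution.\<close>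
  have "bounded (\<Union>i\<in>{1..N}. x0 i ` {-\<tau>..0})"
    using assms(17) by (intro bounded_UN ballI compact_imp_bounded compact_continuous_image) auto
  then obtain R where "R > 0" and R: "\<And>i s. i \<in> {1..N} \<Longrightarrow> s \<in> {-\<tau>..0} \<Longrightarrow> norm (x0 i s) \<le> R"
    unfolding bounded_pos by blast
  have "compact (cball (0::real^'d) R \<times> cball (0::real^'d) R)"
    by (intro compact_Times compact_cball)
  moreover have "cball (0::real^'d) R \<times> cball (0::real^'d) R \<noteq> {}" using \<open>R > 0\<close> by auto
  moreover have "continuous_on (cball 0 R \<times> cball 0 R) \<psi>"
    using assms(9) continuous_on_subset by blast
  \<comment> \<open>Solutions stay in the ball of radius \<open>R\<close>; on the compact product of
    two such balls \<open>\<psi>\<close> attains a positive minimum.\<close>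
  ultimately obtain z0 where z0: "\<And>z. z \<in> cball 0 R \<times> cball 0 R \<Longrightarrow> \<psi> z0 \<le> \<psi> z"
    by (metis continuous_attains_inf)
  define \<beta> where "\<beta> = \<psi> z0 / (real N - 1)"
  have "\<beta> > 0" using assms(10) N by (simp add: \<beta>_def)
  have "K > 0" using K assms(10) less_le_trans by blast
  define q where "q = min 1 (exp (- K * T) * \<beta> * \<alpha>min)"
  have q: "0 < q" "q \<le> 1" "q \<le> exp (- K * T) * \<beta> * \<alpha>min"
    using \<open>\<beta> > 0\<close> assms(15) by (auto simp: q_def)
  define L where "L = real \<gamma> * (T + \<tau>) + \<tau>"
  have "L > 0" using \<tau> assms(14) by (simp add: L_def add_nonneg_pos)
  \<comment> \<open>The contraction factor of the history diameter over one period
    \<open>L\<close>.\<close>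
  define \<rho> where "\<rho> = 1 - q ^ \<gamma> * exp (- K * L) / 2"
  have "0 < q ^ \<gamma> * exp (- K * L)" using q by simp
  moreover have "q ^ \<gamma> * exp (- K * L) \<le> 1 * 1"
    using q \<open>K > 0\<close> \<open>L > 0\<close> by (intro mult_mono power_le_one) auto
  ultimately have \<rho>: "0 < \<rho>" "\<rho> < 1" by (auto simp: \<rho>_def)
  \<comment> \<open>Chosen so that \<open>exp (- C * L) = \<rho>\<close>.\<close>
  define C where "C = - ln \<rho> / L"
  have "C > 0" using \<rho> \<open>L > 0\<close> by (simp add: C_def divide_neg_pos)
  have "diam_at N x t \<le> history_diam N \<tau> x * exp (- C * (t - real \<gamma> * (T + \<tau>) - \<tau>))"
    if sol: "is_solution N G \<psi> \<alpha> delay \<tau> x0 x" and t: "t \<ge> 0" for x t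
  proof -
    define w where "w i j t = arc_indicator G i j * \<alpha> i j t * interaction N \<psi> delay x i j t" for i j t
    have dc: "delayed_consensus {1..N} w delay \<tau> K (\<lambda>i t. v \<bullet> x i t)" for v
      using is_solution_delayed_consensus[OF sol N \<tau> delay assms(10) K \<alpha>] by (simp add: w_def[abs_def])
    have hist: "norm (x i s) \<le> R" if "i \<in> {1..N}" "s \<in> {-\<tau>..0}" for i s
      using sol R[OF that] that by (simp add: is_solution_def)
    have xR: "norm (x i s) \<le> R" if "i \<in> {1..N}" "-\<tau> \<le> s" for i s
      using delayed_consensus_norm_le[OF dc hist that] .
    have ec: "excited_consensus {1..N} w delay \<tau> K (\<lambda>i t. v \<bullet> x i t) (with_proj G) \<alpha> \<alpha>min \<beta> T" for v
    proof (intro excited_consensus.intro dc excited_consensus_axioms.intro)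
      show "verts (with_proj G) = {1..N}" using VG by simp
      have arc: "i \<in> {1..N} \<and> j \<in> {1..N} \<and> i \<noteq> j \<and> arc_indicator G i j = 1"
        if "(i, j) \<in> arcs_ends (with_proj G)" for i j
        using that in_arcsD1[of i j] in_arcsD2[of i j] pair_no_loops[of "(i, j)"] VG
        by (simp add: arc_indicator_def)
      then show "i \<in> {1..N} \<and> j \<in> {1..N} \<and> i \<noteq> j" if "(i, j) \<in> arcs_ends (with_proj G)" for i j
        using that by blast
      show "0 \<le> \<alpha> i j s" if "(i, j) \<in> arcs_ends (with_proj G)" "0 \<le> s" for i j s
        using arc[OF that(1)] \<alpha> that(2) by blast
      show "\<beta> * \<alpha> i j s \<le> w i j s" if "(i, j) \<in> arcs_ends (with_proj G)" "0 \<le> s" for i j s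
      proof -
        have ij: "i \<in> {1..N}" "j \<in> {1..N}" "arc_indicator G i j = 1" using arc[OF that(1)] by auto
        \<comment> \<open>As the delay is at most \<open>\<tau>\<close>, the delayed time is not
          before \<open>-\<tau>\<close>, where the bound \<open>R\<close> still holds.\<close>
        have "x i s \<in> cball 0 R" "x j (s - delay i j s) \<in> cball 0 R"
          using xR[OF ij(1), of s] xR[OF ij(2), of "s - delay i j s"] delay[OF ij(1,2) that(2)] that(2) \<tau> by auto
        then have "\<psi> z0 \<le> \<psi> (x i s, x j (s - delay i j s))" by (intro z0) auto
        then have "\<beta> \<le> interaction N \<psi> delay x i j s"
          using N by (simp add: \<beta>_def interaction_def divide_right_mono)
        then show ?thesis
          using \<alpha>[OF ij(1,2) that(2)] ij(3) by (simp add: w_def mult.commute[of \<beta>] mult_left_mono)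
      qed
      show "\<alpha> i j integrable_on {s..s + T} \<and> \<alpha>min \<le> integral {s..s + T} (\<alpha> i j)"
        if "(i, j) \<in> arcs_ends (with_proj G)" "0 \<le> s" for i j s
      proof -
        have ij: "i \<in> {1..N}" "j \<in> {1..N}" "arc_indicator G i j = 1" using arc[OF that(1)] by auto
        have "{s..s + T} \<subseteq> {0..}" using that(2) by auto
        moreover have "\<bar>\<alpha> i j u\<bar> \<le> 1" if "u \<in> {s..s + T}" for u
          using \<alpha>[OF ij(1,2), of u] that \<open>0 \<le> s\<close> by simp
        ultimately show ?thesis
          using set_lebesgue_integral_bounded[OF assms(12)[OF ij(1,2)], of s "s + T" 1]
            assms(16)[OF ij that(2)] by simp
      qed
    qed (use assms(14) \<open>\<beta> > 0\<close> in auto)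
    have one: "1 \<in> {1..N}" using N by simp
    \<comment> \<open>Vertex 1 serves as the fixed target of all walks; any vertex would do.\<close>
    have walks: "\<exists>p. vwalk p (with_proj G) \<and> hd p = i \<and> last p = 1 \<and> length p - 1 \<le> \<gamma>"
      if "i \<in> {1..N}" for i
      using vwalk_le_digraph_depth[OF assms(5), of i 1] that one VG assms(6) by metis
    define D where "D = history_diam N \<tau> x"
    have osc: "history_diam_le {1..N} \<tau> x (real n * L) (\<rho> ^ n * D)" for n
    proof (induction n)
      case 0
      show ?case using history_diam_le_history_diam[OF hist] by (simp add: D_def)
    next
      case (Suc n)
      have "history_diam_le {1..N} \<tau> x (real n * L + L) (\<rho> * (\<rho> ^ n * D))"
        unfolding \<rho>_def
        by (rule excited_consensus_contraction[OF ec _ Suc.IH[unfolded \<rho>_def] _ q(2,3) one walks L_def])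
           (use \<open>L > 0\<close> q in auto)
      then show ?case by (simp add: algebra_simps)
    qed
    have "D \<ge> 0"
      using osc[of 0] one \<tau> by (force simp: history_diam_le_def intro: order_trans[OF norm_ge_zero])
    \<comment> \<open>The number of complete periods up to \<open>t\<close>. The incomplete last
      period accounts for the shift by \<open>L\<close> in the exponent.\<close>
    define n where "n = nat \<lfloor>t / L\<rfloor>"
    have "real n \<le> t / L" "t / L < real n + 1"
      using t \<open>L > 0\<close> by (auto simp: n_def)
    then have n: "real n * L \<le> t" "t - L \<le> real n * L"
      using \<open>L > 0\<close> by (auto simp: field_simps)
    have "norm (x i t - x j t) \<le> \<rho> ^ n * D" if "i \<in> {1..N}" "j \<in> {1..N}" for i j
      by (rule delayed_consensus_diam_le[OF dc _ osc that n(1)]) (use \<open>L > 0\<close> in simp)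
    then have "diam_at N x t \<le> \<rho> ^ n * D"
      unfolding diam_at_def using one by (subst Max_le_iff) auto
    also have "\<rho> ^ n = exp (- C * (real n * L))"
      using \<rho> \<open>L > 0\<close> by (simp add: C_def exp_of_nat2_mult)
    also have "\<dots> * D \<le> exp (- C * (t - L)) * D"
      using n \<open>C > 0\<close> \<open>D \<ge> 0\<close> by (intro mult_right_mono) auto
    finally show ?thesis by (simp add: D_def L_def mult.commute diff_diff_eq)
  qed
  then show ?thesis using \<open>C > 0\<close> by blast
qed

end
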